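(* (Verdu-Han Lemma for compound channels.) Consider a general compound channel with any uncertainty set $\mathcal{S}$. Every $(n,r_n,\varepsilon_n)$-code satisfies $$\varepsilon_n\ge\sup_{s\in\mathcal{S}}\Pr\Big\{\tfrac1n i(X^n;Y^n|s)\le r_n-\gamma\Big\}-e^{-\gamma n}$$ for any $\gamma>0$, where $X^n$ is uniformly distributed over all codewords and $Y^n$ is the corresponding channel output under channel state $s$.
   Context: A general compound channel is, for each blocklength $n$ and each state $s$ in an arbitrary set $\mathcal{S}$, a transition probability $p_s(y^n|x^n)$ (arbitrary alphabets; sums replaced by integrals if not discrete). For an input $X^n$ with distribution not depending on $s$ and corresponding output $Y^n$ with distribution $p_s(y^n)$ under state $s$, the information density is $i(x^n;y^n|s)=\ln\frac{p_s(y^n|x^n)}{p_s(y^n)}$. The receiver knows $s$, the transmitter does not. An $(n,r_n,\varepsilon_n)$-code has $M_n$ codewords of length $n$ not depending on $s$, decision regions which may depend on $s$, rate $r_n=\frac1n\ln M_n$, and compound error probability $\varepsilon_n=\sup_{s\in\mathcal{S}}\varepsilon_{ns}$, where $\varepsilon_{ns}$ is the error probability under state $s$ (either maximum or average over codewords). *)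

theory Defs
  imports "HOL-Probability.Probability"
begin

text \<open>Sequences of length n over an alphabet are extensional functions on {..<n}. The output
  alphabet is a measurable space; only its sigma-algebra matters. The function trans_dens Ch n s x
  is the density p_s(y|x), in y, with respect to the reference measure ref Ch n s
  on output sequences: the counting measure in the discrete case (p_s is then a mass function),
  Lebesgue measure for ordinary densities. The reference measure is arbitrary (not necessarily
  sigma-finite) and may depend on the state.\<close>

record ('s, 'a, 'b) channel =
  states :: "'s set"
  in_alph :: "'a set"
  out_alph :: "'b measure"
  ref :: "nat \<Rightarrow> 's \<Rightarrow> (nat \<Rightarrow> 'b) measure"
  trans_dens :: "nat \<Rightarrow> 's \<Rightarrow> (nat \<Rightarrow> 'a) \<Rightarrow> (nat \<Rightarrow> 'b) \<Rightarrow> real"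

definition in_seqs :: "('s, 'a, 'b) channel \<Rightarrow> nat \<Rightarrow> (nat \<Rightarrow> 'a) set" where
  "in_seqs Ch n = (\<Pi>\<^sub>E i\<in>{..<n}. in_alph Ch)"

definition out_seqs :: "('s, 'a, 'b) channel \<Rightarrow> nat \<Rightarrow> (nat \<Rightarrow> 'b) measure" where
  "out_seqs Ch n = (\<Pi>\<^sub>M i\<in>{..<n}. out_alph Ch)"

definition compound_channel :: "('s, 'a, 'b) channel \<Rightarrow> bool" where
  "compound_channel Ch \<longleftrightarrow>
     (\<forall>n>0. \<forall>s\<in>states Ch.
        sets (ref Ch n s) = sets (out_seqs Ch n) \<and>
        (\<forall>x\<in>in_seqs Ch n.
           trans_dens Ch n s x \<in> borel_measurable (out_seqs Ch n) \<and>
           (\<forall>y\<in>space (out_seqs Ch n). 0 \<le> trans_dens Ch n s x y) \<and>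
           (\<integral>\<^sup>+ y. ennreal (trans_dens Ch n s x y) \<partial>ref Ch n s) = 1))"

definition trans_prob ::
    "('s, 'a, 'b) channel \<Rightarrow> nat \<Rightarrow> 's \<Rightarrow> (nat \<Rightarrow> 'a) \<Rightarrow> (nat \<Rightarrow> 'b) measure" where
  "trans_prob Ch n s x = density (ref Ch n s) (\<lambda>y. ennreal (trans_dens Ch n s x y))"

definition out_dens ::
    "('s, 'a, 'b) channel \<Rightarrow> (nat \<Rightarrow> 'a) pmf \<Rightarrow> nat \<Rightarrow> 's \<Rightarrow> (nat \<Rightarrow> 'b) \<Rightarrow> real" where
  "out_dens Ch X n s y = measure_pmf.expectation X (\<lambda>x. trans_dens Ch n s x y)"

text \<open>Since ln 0 = 0 and z / 0 = 0 in HOL, this value is a dummy where one of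
  the densities vanishes. For an input pmf X the points (x, y) with trans_dens Ch n s x y = 0 or
  out_dens Ch X n s y = 0 have joint probability zero if X is finitely supported on
  in_seqs Ch n, so the distribution of the information density is not affected.\<close>

definition info_dens ::
    "('s, 'a, 'b) channel \<Rightarrow> (nat \<Rightarrow> 'a) pmf \<Rightarrow> nat \<Rightarrow> 's \<Rightarrow> (nat \<Rightarrow> 'a) \<Rightarrow> (nat \<Rightarrow> 'b) \<Rightarrow> real" where
  "info_dens Ch X n s x y = ln (trans_dens Ch n s x y / out_dens Ch X n s y)"

text \<open>The probability, under state s, that (x, y) satisfies P, where x is drawn from X and then
  y from the transition probability given x. Defining it by conditioning on x
  avoids a sigma-algebra on the input sequences.\<close>

definition joint_prob ::
    "('s, 'a, 'b) channel \<Rightarrow> (nat \<Rightarrow> 'a) pmf \<Rightarrow> nat \<Rightarrow> 's \<Rightarrow> ((nat \<Rightarrow> 'a) \<Rightarrow> (nat \<Rightarrow> 'b) \<Rightarrow> bool) \<Rightarrow> real" where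
  "joint_prob Ch X n s P =
     measure_pmf.expectation X
       (\<lambda>x. measure (trans_prob Ch n s x) {y \<in> space (out_seqs Ch n). P x y})"

text \<open>The messages are {..<num C}. The codewords do not depend on the state, the decision
  regions do (the receiver knows the state).\<close>

record ('s, 'a, 'b) code =
  num :: nat
  codeword :: "nat \<Rightarrow> nat \<Rightarrow> 'a"
  region :: "'s \<Rightarrow> nat \<Rightarrow> (nat \<Rightarrow> 'b) set"

text \<open>The uniform distribution over the codewords, counted with multiplicity if
  a codeword is used for several messages.\<close>

definition codeword_pmf :: "('s, 'a, 'b) code \<Rightarrow> (nat \<Rightarrow> 'a) pmf" where
  "codeword_pmf C = map_pmf (codeword C) (pmf_of_set {..<num C})"

datatype criterion = Maximum | Average

definition msg_error :: "('s, 'a, 'b) channel \<Rightarrow> nat \<Rightarrow> ('s, 'a, 'b) code \<Rightarrow> 's \<Rightarrow> nat \<Rightarrow> real" where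
  "msg_error Ch n C s m =
     measure (trans_prob Ch n s (codeword C m)) (space (out_seqs Ch n) - region C s m)"

fun state_error ::
    "criterion \<Rightarrow> ('s, 'a, 'b) channel \<Rightarrow> nat \<Rightarrow> ('s, 'a, 'b) code \<Rightarrow> 's \<Rightarrow> real" where
  "state_error Maximum Ch n C s = Max (msg_error Ch n C s ` {..<num C})"
| "state_error Average Ch n C s = (\<Sum>m<num C. msg_error Ch n C s m) / real (num C)"

definition compound_error ::
    "criterion \<Rightarrow> ('s, 'a, 'b) channel \<Rightarrow> nat \<Rightarrow> ('s, 'a, 'b) code \<Rightarrow> real" where
  "compound_error crit Ch n C = (SUP s\<in>states Ch. state_error crit Ch n C s)"

text \<open>The decision regions need not cover the output space: an output outside all of them counts
  as an error for every message.\<close>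

definition is_code ::
    "criterion \<Rightarrow> ('s, 'a, 'b) channel \<Rightarrow> nat \<Rightarrow> real \<Rightarrow> real \<Rightarrow> ('s, 'a, 'b) code \<Rightarrow> bool" where
  "is_code crit Ch n r \<epsilon> C \<longleftrightarrow>
     n > 0 \<and> num C > 0 \<and>
     (\<forall>m<num C. codeword C m \<in> in_seqs Ch n) \<and>
     (\<forall>s\<in>states Ch. (\<forall>m<num C. region C s m \<in> sets (out_seqs Ch n)) \<and>
                     disjoint_family_on (region C s) {..<num C}) \<and>
     r = ln (real (num C)) / real n \<and>
     \<epsilon> = compound_error crit Ch n C"

end

theory Submission
  imports Defs
begin

text \<open>Fix a state. On the event that the information density is at most \<open>n (r - \<gamma>)\<close>, the density
  of codeword \<open>m\<close> is at most \<open>exp (- \<gamma> n)\<close> times the sum of all codeword densities. Split this event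
  along the decision region of \<open>m\<close>: the part outside contributes at most the error probability,
  and, the regions being disjoint, the parts inside contribute on average at most \<open>exp (- \<gamma> n)\<close>.
  The average error is at most the maximum error, so both criteria follow; finally take the supremum
  over the states.\<close>

text \<open>Integrates the pointwise bound over \<open>A\<close>. The computation stays in the
  extended nonnegative reals, so integrability of \<open>f\<close> need not be assumed; finiteness
  of the measures with densities \<open>g i\<close> brings the bound back to the reals. It serves to
  trade the output law of one codeword for the sum of the laws of all codewords.\<close>

lemma measure_density_le_sum:
  fixes f :: "'a \<Rightarrow> real" and g :: "'i \<Rightarrow> 'a \<Rightarrow> real"
  assumes f: "f \<in> borel_measurable N"
    and g: "\<And>i. i \<in> I \<Longrightarrow> g i \<in> borel_measurable N"
    and g0: "\<And>i x. i \<in> I \<Longrightarrow> x \<in> space N \<Longrightarrow> 0 \<le> g i x"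
    and fin: "\<And>i. i \<in> I \<Longrightarrow> finite_measure (density N (\<lambda>x. ennreal (g i x)))"
    and A: "A \<in> sets N" and c: "0 \<le> c"
    and le: "\<And>x. x \<in> A \<Longrightarrow> f x \<le> c * (\<Sum>i\<in>I. g i x)"
  shows "measure (density N (\<lambda>x. ennreal (f x))) A
    \<le> c * (\<Sum>i\<in>I. measure (density N (\<lambda>x. ennreal (g i x))) A)"
proof -
  have "emeasure (density N (\<lambda>x. ennreal (f x))) A = (\<integral>\<^sup>+x. ennreal (f x) * indicator A x \<partial>N)"
    using f A by (subst emeasure_density) auto
  also have "\<dots> \<le> (\<integral>\<^sup>+x. ennreal c * (\<Sum>i\<in>I. ennreal (g i x) * indicator A x) \<partial>N)"
  proof (rule nn_integral_mono)
    fix x assume x: "x \<in> space N"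
    show "ennreal (f x) * indicator A x
      \<le> ennreal c * (\<Sum>i\<in>I. ennreal (g i x) * indicator A x)"
    proof (cases "x \<in> A")
      case True
      have "ennreal (f x) \<le> ennreal (c * (\<Sum>i\<in>I. g i x))"
        using le[OF True] by (rule ennreal_leI)
      also have "\<dots> = ennreal c * (\<Sum>i\<in>I. ennreal (g i x))"
        using c g0 x by (simp add: ennreal_mult sum_nonneg sum_ennreal)
      finally show ?thesis using True by simp
    qed simp
  qed
  also have "\<dots> = ennreal c * (\<Sum>i\<in>I. \<integral>\<^sup>+x. ennreal (g i x) * indicator A x \<partial>N)"
    using g A by (subst nn_integral_cmult, measurable, subst nn_integral_sum, measurable)
  also have "\<dots> = ennreal c * (\<Sum>i\<in>I. emeasure (density N (\<lambda>x. ennreal (g i x))) A)"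
    using g A by (simp add: emeasure_density)
  also have "\<dots> = ennreal (c * (\<Sum>i\<in>I. measure (density N (\<lambda>x. ennreal (g i x))) A))"
    using c fin by (simp add: finite_measure.emeasure_eq_measure ennreal_mult sum_nonneg sum_ennreal)
  finally show ?thesis
    using c by (subst (1) measure_def) (intro enn2real_leI mult_nonneg_nonneg sum_nonneg, auto)
qed

lemma expectation_codeword_pmf:
  fixes f :: "_ \<Rightarrow> real"
  assumes "num C > 0"
  shows "measure_pmf.expectation (codeword_pmf C) f
    = (\<Sum>m<num C. f (codeword C m)) / real (num C)"
  using assms unfolding codeword_pmf_def
  by (subst integral_map_pmf, subst integral_pmf_of_set) auto

lemma prob_space_trans_prob:
  assumes "compound_channel Ch" "n > 0" "s \<in> states Ch" "x \<in> in_seqs Ch n"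
  shows "prob_space (trans_prob Ch n s x)"
proof
  have eq: "sets (ref Ch n s) = sets (out_seqs Ch n)"
    and meas: "trans_dens Ch n s x \<in> borel_measurable (out_seqs Ch n)"
    and int: "(\<integral>\<^sup>+ y. ennreal (trans_dens Ch n s x y) \<partial>ref Ch n s) = 1"
    using assms unfolding compound_channel_def by auto
  have "trans_dens Ch n s x \<in> borel_measurable (ref Ch n s)"
    using meas measurable_cong_sets[OF eq refl] by auto
  then have "emeasure (trans_prob Ch n s x) (space (ref Ch n s))
    = (\<integral>\<^sup>+ y. ennreal (trans_dens Ch n s x y) * indicator (space (ref Ch n s)) y \<partial>ref Ch n s)"
    unfolding trans_prob_def by (subst emeasure_density) auto
  also have "\<dots> = 1"
    unfolding int[symmetric] by (intro nn_integral_cong) simp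
  finally show "emeasure (trans_prob Ch n s x) (space (trans_prob Ch n s x)) = 1"
    by (simp add: trans_prob_def)
qed

text \<open>For uniform input the output density is the sum of the codeword densities divided by
  \<open>num C\<close>. The information density thus contains a summand \<open>ln (num C)\<close>,
  which is exactly n times the rate; it cancels and leaves a bound on the ratio of one density to
  the sum.\<close>

lemma trans_dens_le_of_info_dens_le:
  assumes p: "\<And>m. m < num C \<Longrightarrow> 0 \<le> trans_dens Ch n s (codeword C m) y"
    and m: "m < num C" and n: "n > 0"
    and i: "1 / real n * info_dens Ch (codeword_pmf C) n s (codeword C m) y
              \<le> ln (real (num C)) / real n - \<gamma>"
  shows "trans_dens Ch n s (codeword C m) y
    \<le> exp (- \<gamma> * real n) * (\<Sum>k<num C. trans_dens Ch n s (codeword C k) y)"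
proof -
  let ?p = "\<lambda>k. trans_dens Ch n s (codeword C k) y"
  let ?S = "\<Sum>k<num C. ?p k"
  have M: "num C > 0" using m by simp
  have S: "?p m \<le> ?S"
    using p m by (intro member_le_sum) auto
  show ?thesis
  proof (cases "?p m = 0")
    \<comment> \<open>Here \<open>info_dens\<close> has the dummy value \<open>ln 0 = 0\<close>, so
      the hypothesis carries no information; the bound holds because the sum is nonnegative.\<close>
    case True
    then show ?thesis using S by simp
  next
    case False
    then have pm: "?p m > 0" using p[OF m] by simp
    then have S0: "?S > 0" using S by simp
    have "ln (?p m / (?S / real (num C))) \<le> ln (real (num C)) - \<gamma> * real n"
      using i n M unfolding info_dens_def out_dens_def
      by (simp add: expectation_codeword_pmf field_simps)
    also have "ln (?p m / (?S / real (num C))) = ln (?p m / ?S) + ln (real (num C))"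
      using pm S0 M by (subst ln_mult_pos[symmetric]) (auto simp: field_simps)
    finally have "ln (?p m / ?S) \<le> - \<gamma> * real n" by simp
    then have "?p m / ?S \<le> exp (- \<gamma> * real n)"
      using pm S0 exp_le_cancel_iff[of "ln (?p m / ?S)"] by simp
    then show ?thesis using S0 by (simp add: field_simps)
  qed
qed

text \<open>The bound for a single state. It is stated for the average error, the smaller of the two
  criteria, so that it yields both.\<close>

lemma joint_prob_le_average_error:
  assumes ch: "compound_channel Ch" and code: "is_code crit Ch n r \<epsilon> C" and s: "s \<in> states Ch"
  shows "joint_prob Ch (codeword_pmf C) n s
      (\<lambda>x y. 1 / real n * info_dens Ch (codeword_pmf C) n s x y \<le> r - \<gamma>)
    \<le> state_error Average Ch n C s + exp (- \<gamma> * real n)"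
proof -
  define M where "M = num C"
  define P where "P m = trans_prob Ch n s (codeword C m)" for m
  define p where "p m = trans_dens Ch n s (codeword C m)" for m
  define D where "D = region C s"
  define N where "N = out_seqs Ch n"
  define e where "e = exp (- \<gamma> * real n)"
  define B where "B m = {y \<in> space N. 1 / real n *
      info_dens Ch (codeword_pmf C) n s (codeword C m) y \<le> r - \<gamma>}" for m
  have n: "n > 0" and M: "M > 0" and r: "r = ln (real (num C)) / real n"
    and c: "\<And>m. m < M \<Longrightarrow> codeword C m \<in> in_seqs Ch n"
    and D: "\<And>m. m < M \<Longrightarrow> D m \<in> sets N" and disj: "disjoint_family_on D {..<M}"
    using code s unfolding is_code_def M_def D_def N_def by auto
  have ref: "sets (ref Ch n s) = sets N"
    using ch n s unfolding compound_channel_def N_def by auto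
  have p: "p m \<in> borel_measurable N" "\<And>y. y \<in> space N \<Longrightarrow> 0 \<le> p m y" if "m < M" for m
    using ch n s c[OF that] unfolding compound_channel_def N_def p_def by auto
  have P: "prob_space (P m)" if "m < M" for m
    unfolding P_def by (rule prob_space_trans_prob[OF ch n s c[OF that]])
  have P_density: "P m = density (ref Ch n s) (\<lambda>y. ennreal (p m y))" for m
    unfolding P_def p_def trans_prob_def ..
  have sets_P [simp]: "sets (P m) = sets N" for m
    unfolding P_density using ref by simp
  have B: "B m \<in> sets N" if m: "m < M" for m
  proof -
    \<comment> \<open>Writing the expectation in \<open>out_dens\<close> as a finite sum over
      messages makes measurability in y evident.\<close>
    have "(\<lambda>y. info_dens Ch (codeword_pmf C) n s (codeword C m) y) =
        (\<lambda>y. ln (p m y / ((\<Sum>k<M. p k y) / real M)))"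
      unfolding info_dens_def out_dens_def p_def M_def
      using M by (simp add: expectation_codeword_pmf M_def)
    moreover have "(\<lambda>y. ln (p m y / ((\<Sum>k<M. p k y) / real M))) \<in> borel_measurable N"
      using p m by measurable
    ultimately have [measurable]:
      "(\<lambda>y. info_dens Ch (codeword_pmf C) n s (codeword C m) y) \<in> borel_measurable N" by simp
    show ?thesis unfolding B_def by measurable
  qed
  have inside: "measure (P m) (B m \<inter> D m) \<le> e * (\<Sum>k<M. measure (P k) (D m))" if m: "m < M" for m
  proof -
    have "measure (P m) (B m \<inter> D m) \<le> e * (\<Sum>k<M. measure (P k) (B m \<inter> D m))"
      unfolding P_density
    proof (rule measure_density_le_sum)
      fix y assume y: "y \<in> B m \<inter> D m"
      then show "p m y \<le> e * (\<Sum>k<M. p k y)"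
        unfolding p_def e_def M_def
        using p(2) m n by (intro trans_dens_le_of_info_dens_le) (auto simp: B_def M_def p_def r)
    qed (use p m B D ref P in \<open>auto simp: e_def P_density[symmetric] prob_space_def
           measurable_cong_sets[OF ref refl] sets_eq_imp_space_eq[OF ref]\<close>)
    \<comment> \<open>Enlarging \<open>B m \<inter> D m\<close> to \<open>D m\<close> leaves only
      decision regions, whose masses under each fixed \<open>P k\<close> add up to at most
      1.\<close>
    also have "\<dots> \<le> e * (\<Sum>k<M. measure (P k) (D m))"
      unfolding e_def using D m P
      by (intro mult_left_mono sum_mono finite_measure.finite_measure_mono)
        (auto simp: prob_space_def)
    finally show ?thesis .
  qed
  have bound: "measure (P m) (B m) \<le> msg_error Ch n C s m + e * (\<Sum>k<M. measure (P k) (D m))"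
    if m: "m < M" for m
  proof -
    interpret prob_space "P m" by (rule P[OF m])
    have "measure (P m) (B m) \<le> measure (P m) ((space N - D m) \<union> (B m \<inter> D m))"
      using B[OF m] D[OF m] by (intro finite_measure_mono) (auto simp: B_def)
    also have "\<dots> \<le> measure (P m) (space N - D m) + measure (P m) (B m \<inter> D m)"
      using B[OF m] D[OF m] by (intro measure_Un_le) auto
    finally show ?thesis
      using inside[OF m] unfolding msg_error_def P_def N_def D_def by simp
  qed
  \<comment> \<open>Only an inequality, since the regions need not cover the output space.\<close>
  have total: "(\<Sum>m<M. measure (P k) (D m)) \<le> 1" if "k < M" for k
  proof -
    interpret prob_space "P k" by (rule P[OF that])
    have "(\<Sum>m<M. measure (P k) (D m)) = measure (P k) (\<Union>m<M. D m)"
      using D disj by (intro finite_measure_finite_Union[symmetric]) auto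
    then show ?thesis by simp
  qed
  have "(\<Sum>m<M. measure (P m) (B m))
    \<le> (\<Sum>m<M. msg_error Ch n C s m) + e * (\<Sum>m<M. \<Sum>k<M. measure (P k) (D m))"
    unfolding sum_distrib_left[of e] sum.distrib[symmetric]
    using bound by (intro sum_mono) (auto simp: sum_distrib_left)
  \<comment> \<open>With the codeword k fixed outside, the inner sum runs over disjoint regions. The
    M codewords contribute at most M in total, which the division by M turns into the single term
    \<open>e\<close>.\<close>
  also have "(\<Sum>m<M. \<Sum>k<M. measure (P k) (D m)) = (\<Sum>k<M. \<Sum>m<M. measure (P k) (D m))"
    by (rule sum.swap)
  also have "(\<Sum>k<M. \<Sum>m<M. measure (P k) (D m)) \<le> real M"
    using sum_mono[of "{..<M}" "\<lambda>k. \<Sum>m<M. measure (P k) (D m)" "\<lambda>_. 1"] total by simp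
  finally have "(\<Sum>m<M. measure (P m) (B m)) \<le> (\<Sum>m<M. msg_error Ch n C s m) + e * real M"
    by (simp add: e_def)
  then have "(\<Sum>m<M. measure (P m) (B m)) / real M
      \<le> (\<Sum>m<M. msg_error Ch n C s m) / real M + e"
    using M by (simp add: field_simps)
  then show ?thesis
    using M unfolding joint_prob_def B_def P_def M_def N_def e_def
    by (simp add: expectation_codeword_pmf)
qed

lemma average_error_le_state_error:
  assumes "num C > 0"
  shows "state_error Average Ch n C s \<le> state_error crit Ch n C s"
proof (cases crit)
  case Maximum
  have "(\<Sum>m<num C. msg_error Ch n C s m)
    \<le> real (num C) * Max (msg_error Ch n C s ` {..<num C})"
    using sum_bounded_above[of "{..<num C}" "msg_error Ch n C s"] by simp
  then show ?thesis using assms Maximum by (simp add: field_simps)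
qed simp

text \<open>Bounds the state errors uniformly, so that their supremum over the states, taken in the
  reals, is a true upper bound.\<close>

lemma state_error_le_1:
  assumes "compound_channel Ch" "is_code crit Ch n r \<epsilon> C" "s \<in> states Ch"
  shows "state_error crit' Ch n C s \<le> 1"
proof -
  have M: "num C > 0" and n: "n > 0" using assms(2) unfolding is_code_def by auto
  have le: "msg_error Ch n C s m \<le> 1" if "m < num C" for m
    unfolding msg_error_def
    using assms that n by (intro prob_space.prob_le_1 prob_space_trans_prob) (auto simp: is_code_def)
  show ?thesis
  proof (cases crit')
    case Maximum
    then show ?thesis using le M by (auto simp: lessThan_empty_iff)
  next
    case Average
    have "(\<Sum>m<num C. msg_error Ch n C s m) \<le> real (num C)"
      using sum_mono[of "{..<num C}" "msg_error Ch n C s" "\<lambda>_. 1"] le by simp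
    then show ?thesis using Average M by simp
  qed
qed

theorem lemma4:
  fixes Ch :: "('s, 'a, 'b) channel" and C :: "('s, 'a, 'b) code"
    and crit :: criterion and n :: nat and r \<epsilon> \<gamma> :: real
  assumes "compound_channel Ch"
    and "is_code crit Ch n r \<epsilon> C"
    and "\<gamma> > 0"
  shows "\<epsilon> \<ge> (SUP s\<in>states Ch.
                 joint_prob Ch (codeword_pmf C) n s
                   (\<lambda>x y. 1 / real n * info_dens Ch (codeword_pmf C) n s x y \<le> r - \<gamma>))
             - exp (- \<gamma> * real n)"
proof -
  have \<epsilon>: "\<epsilon> = (SUP s\<in>states Ch. state_error crit Ch n C s)" and M: "num C > 0"
    using assms(2) unfolding is_code_def compound_error_def by auto
  show ?thesis
  proof (cases "states Ch = {}")
    \<comment> \<open>Both suprema are then the same value \<open>Sup {}\<close>, whatever it is,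
      and subtracting a positive exponential makes the right side smaller.\<close>
    case True
    then show ?thesis unfolding \<epsilon> by simp
  next
    case False
    have "(SUP s\<in>states Ch. joint_prob Ch (codeword_pmf C) n s
          (\<lambda>x y. 1 / real n * info_dens Ch (codeword_pmf C) n s x y \<le> r - \<gamma>))
        \<le> \<epsilon> + exp (- \<gamma> * real n)"
    \<comment> \<open>The bound does not depend on the state, so for a nonempty state set it passes
      to the supremum.\<close>
    proof (rule cSUP_least[OF False])
      fix s assume s: "s \<in> states Ch"
      have "state_error crit Ch n C s \<le> \<epsilon>"
        unfolding \<epsilon> using state_error_le_1[OF assms(1,2)]
        by (intro cSUP_upper[OF s] bdd_aboveI2)
      then show "joint_prob Ch (codeword_pmf C) n s
          (\<lambda>x y. 1 / real n * info_dens Ch (codeword_pmf C) n s x y \<le> r - \<gamma>)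
        \<le> \<epsilon> + exp (- \<gamma> * real n)"
        using joint_prob_le_average_error[OF assms(1,2) s]
          average_error_le_state_error[OF M, of Ch n s crit]
        by (meson add_right_mono order_trans)
    qed
    then show ?thesis by simp
  qed
qed

end
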